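(* Let $\Omega \subset \mathbb{R}^d$ be a bounded open domain. Let $g, h \in C(\bar{\Omega})$ be such that $h|_{\partial \Omega} = 0$ and $g > 0$ on $\Omega$. Then there exists a sequence of functions $(f_n)_{n \in \mathbb{N}} \subset C(\bar{\Omega})$ such that $$\| f_n g - h \|_{\infty, \Omega} \longrightarrow 0 \quad \text{as } n \to \infty.$$
   Context: $C(\bar{\Omega})$ denotes the space of real-valued continuous functions on the closure $\bar{\Omega}$, $\partial\Omega$ is the topological boundary of $\Omega$, and $\|f\|_{\infty,\Omega} := \sup_{x \in \Omega} |f(x)|$. *)

theory Defs
  imports "HOL-Analysis.Analysis"
begin

(* The supremum is taken in the reals, so it is meaningful only if S is nonempty and f is bounded
   on S; both hold when S is nonempty and bounded and f is continuous on the closure of S. *)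
definition sup_norm_on :: "'a set \<Rightarrow> ('a \<Rightarrow> real) \<Rightarrow> real" where
  "sup_norm_on S f = (SUP x\<in>S. \<bar>f x\<bar>)"

end

theory Submission
  imports Defs
begin

text \<open>
  The truncation of \<open>h\<close> that removes the values in \<open>[-e, e]\<close> is uniformly \<open>e\<close>-close to \<open>h\<close> and
  vanishes off the compact set \<open>{\<bar>h\<bar> \<ge> e}\<close>. That set lies inside the region where \<open>g > 0\<close>, so \<open>g\<close> is
  bounded below on it by some \<open>\<delta> > 0\<close>, and dividing by \<open>max \<delta> g\<close> there amounts to dividing by \<open>g\<close>.
\<close>

lemma approx_by_continuous_multiple:
  fixes g h :: "'a::metric_space \<Rightarrow> real"
  assumes S: "compact S" and g: "continuous_on S g" and h: "continuous_on S h"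
    and pos: "\<And>x. x \<in> S \<Longrightarrow> h x \<noteq> 0 \<Longrightarrow> g x > 0" and e: "e > 0"
  shows "\<exists>f. continuous_on S f \<and> (\<forall>x\<in>S. \<bar>f x * g x - h x\<bar> \<le> e)"
proof -
  let ?K = "{x \<in> S. e \<le> \<bar>h x\<bar>}"
  have "\<exists>\<delta>>0. \<forall>x\<in>?K. \<delta> \<le> g x"
  proof (cases "?K = {}")
    case True
    then show ?thesis by (metis empty_iff zero_less_one)
  next
    case False
    have "closedin (top_of_set S) (S \<inter> (\<lambda>x. \<bar>h x\<bar>) -` {e..})"
      by (intro continuous_closedin_preimage continuous_intros h closed_atLeast)
    moreover have "S \<inter> (\<lambda>x. \<bar>h x\<bar>) -` {e..} = ?K" by auto
    ultimately have "compact ?K" using closedin_compact[OF S] by simp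
    moreover have "continuous_on ?K g" using g by (rule continuous_on_subset) auto
    ultimately obtain z where "z \<in> ?K" "\<forall>x\<in>?K. g z \<le> g x"
      using continuous_attains_inf[OF _ False] by blast
    \<comment> \<open>At the minimiser \<open>z\<close>, \<bar>h z\<bar> \<ge> e > 0 forces
      \<open>h z\<close> to be nonzero, so \<open>pos\<close> makes the minimum \<open>g z\<close> a
      valid \<delta>.\<close>
    then show ?thesis using pos[of z] e by (intro exI[of _ "g z"]) auto
  qed
  then obtain \<delta> where \<delta>: "\<delta> > 0" "\<And>x. x \<in> ?K \<Longrightarrow> \<delta> \<le> g x" by blast
  \<comment> \<open>Subtracting the clamp of \<open>h\<close> to [-e, e], rather than cutting
    \<open>h\<close> off where it is small, keeps \<open>t\<close> continuous.\<close>
  define t where "t x = h x - max (- e) (min e (h x))" for x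
  \<comment> \<open>The denominator is at least \<delta> on all of \<open>S\<close>, even where
    \<open>g\<close> vanishes or is negative.\<close>
  have "continuous_on S (\<lambda>x. t x / max \<delta> (g x))"
    unfolding t_def using \<delta>(1) by (intro continuous_intros g h) auto
  moreover have "\<bar>t x / max \<delta> (g x) * g x - h x\<bar> \<le> e" if "x \<in> S" for x
  proof -
    have "t x / max \<delta> (g x) * g x = t x"
    proof (cases "x \<in> ?K")
      case True
      with \<delta> have "\<delta> \<le> g x" by blast
      with \<delta>(1) show ?thesis by (simp add: max_def)
    next
      case False
      with \<open>x \<in> S\<close> have "t x = 0" by (auto simp: t_def max_def min_def)
      then show ?thesis by simp
    qed
    then show ?thesis using e by (auto simp: t_def max_def min_def)
  qed
  ultimately show ?thesis by blast
qed

text \<open>A real supremum is informative only for a nonempty set that is bounded above; the bound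
  \<open>e\<close> provides the latter, and then any single value \<bar>f x\<bar> lies below the
  supremum.\<close>

lemma sup_norm_on_nonneg:
  assumes "S \<noteq> {}" and "\<And>x. x \<in> S \<Longrightarrow> \<bar>f x\<bar> \<le> e"
  shows "0 \<le> sup_norm_on S f"
proof -
  obtain x where x: "x \<in> S" using assms(1) by blast
  have "bdd_above ((\<lambda>x. \<bar>f x\<bar>) ` S)" using assms(2) by (rule bdd_aboveI2)
  with x have "\<bar>f x\<bar> \<le> sup_norm_on S f" unfolding sup_norm_on_def by (rule cSUP_upper)
  then show ?thesis by linarith
qed

lemma sup_norm_on_le:
  assumes "S \<noteq> {}" and "\<And>x. x \<in> S \<Longrightarrow> \<bar>f x\<bar> \<le> e"
  shows "sup_norm_on S f \<le> e"
  unfolding sup_norm_on_def using assms by (rule cSUP_least)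

theorem theorem2p2:
  fixes \<Omega> :: "(real ^ 'd) set"
    and g h :: "real ^ 'd \<Rightarrow> real"
  assumes "open \<Omega>" and "bounded \<Omega>" and "\<Omega> \<noteq> {}"
    and "continuous_on (closure \<Omega>) g"
    and "continuous_on (closure \<Omega>) h"
    and "\<forall>x\<in>frontier \<Omega>. h x = 0"
    and "\<forall>x\<in>\<Omega>. g x > 0"
  shows "\<exists>f :: nat \<Rightarrow> real ^ 'd \<Rightarrow> real.
           (\<forall>n. continuous_on (closure \<Omega>) (f n)) \<and>
           (\<lambda>n. sup_norm_on \<Omega> (\<lambda>x. f n x * g x - h x)) \<longlonglongrightarrow> 0"
proof -
  \<comment> \<open>Since \<Omega> is open, its closure is \<Omega> together with the frontier,
    where \<open>h\<close> vanishes; so such an \<open>x\<close> lies in \<Omega>.\<close>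
  have pos: "g x > 0" if "x \<in> closure \<Omega>" "h x \<noteq> 0" for x
    using that assms(1,6,7) by (auto simp: frontier_def interior_open)
  \<comment> \<open>Boundedness of \<Omega> makes its closure compact; \<open>Suc n\<close> keeps
    the tolerance positive at n = 0.\<close>
  have "\<exists>f. continuous_on (closure \<Omega>) f \<and>
      (\<forall>x\<in>closure \<Omega>. \<bar>f x * g x - h x\<bar> \<le> inverse (real (Suc n)))" for n
    using assms(2,4,5) pos by (intro approx_by_continuous_multiple) auto
  then obtain f where cont: "\<And>n. continuous_on (closure \<Omega>) (f n)"
    and "\<And>n x. x \<in> closure \<Omega> \<Longrightarrow> \<bar>f n x * g x - h x\<bar> \<le> inverse (real (Suc n))"
    by metis
  then have bound: "\<bar>f n x * g x - h x\<bar> \<le> inverse (real (Suc n))" if "x \<in> \<Omega>" for n x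
    using that closure_subset by blast
  have "(\<lambda>n. sup_norm_on \<Omega> (\<lambda>x. f n x * g x - h x)) \<longlonglongrightarrow> 0"
  proof (rule tendsto_sandwich[OF _ _ tendsto_const LIMSEQ_inverse_real_of_nat])
    show "\<forall>\<^sub>F n in sequentially. 0 \<le> sup_norm_on \<Omega> (\<lambda>x. f n x * g x - h x)"
      using sup_norm_on_nonneg[OF assms(3) bound] by (intro always_eventually allI)
    show "\<forall>\<^sub>F n in sequentially.
        sup_norm_on \<Omega> (\<lambda>x. f n x * g x - h x) \<le> inverse (real (Suc n))"
      using sup_norm_on_le[OF assms(3) bound] by (intro always_eventually allI)
  qed
  with cont show ?thesis by blast
qed

end
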